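(* The following equality holds: $$\lim_{k \to \infty} \sum_{\substack{n \geq 1 \\ s_2(n) = k}} \frac{1}{n} = 2 \log 2.$$
   Context: For an integer $n \ge 0$, $s_2(n)$ denotes the sum of the binary digits of $n$ (equivalently, the number of $1$'s in the base-$2$ expansion of $n$). The inner sum runs over all integers $n \ge 1$ with $s_2(n) = k$. $\log$ is the natural logarithm. *)

theory Defs
  imports "HOL-Analysis.Analysis"
begin

fun s2 :: "nat \<Rightarrow> nat" where
  "s2 n = (if n = 0 then 0 else n mod 2 + s2 (n div 2))"

declare s2.simps [simp del]

lemma finite_bits_nat: "finite {i. bit (n :: nat) i}"
proof (rule finite_subset)
  show "{i. bit n i} \<subseteq> {..<n}"
  proof
    fix i assume "i \<in> {i. bit n i}"
    then have "n div 2 ^ i \<noteq> 0" by (metis bit_iff_odd even_zero mem_Collect_eq)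
    then have "2 ^ i \<le> n" by (metis div_less not_le)
    then show "i \<in> {..<n}" by (simp add: less_le_trans[OF less_exp])
  qed
qed simp

lemma s2_eq_card_bits: "s2 n = card {i. bit n i}"
proof (induction n rule: s2.induct)
  case (1 n)
  show ?case
  proof (cases "n = 0")
    case False
    have "{i. bit n i} = (if odd n then {0} else {}) \<union> Suc ` {i. bit (n div 2) i}"
    proof (rule set_eqI)
      fix i show "i \<in> {i. bit n i} \<longleftrightarrow>
        i \<in> (if odd n then {0} else {}) \<union> Suc ` {i. bit (n div 2) i}"
        by (cases i) (auto simp: bit_0 bit_Suc)
    qed
    then have "card {i. bit n i} = n mod 2 + card {i. bit (n div 2) i}"
      using finite_bits_nat[of "n div 2"]
      by (auto simp: card_image card_insert_if odd_iff_mod_2_eq_one)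
    then show ?thesis using 1 False by (simp add: s2.simps[of n])
  qed (simp add: s2.simps)
qed

end

theory Submission imports Defs begin

text \<open>
  Write \<open>S k\<close> for the sum of \<open>1 / n\<close> over the positive integers with exactly \<open>k\<close> binary ones.
  Every positive integer is uniquely \<open>n = 2 ^ j * (2 * m + 1)\<close>, and the number of ones of \<open>n\<close>
  is one more than that of \<open>m\<close>. Summing the geometric series over \<open>j\<close> gives
  \<open>S (k + 1) = \<Sum> 2 / (2 * m + 1)\<close>, the sum ranging over the \<open>m\<close> with \<open>k\<close> ones
  (\<open>has_sum_inverse_s2_Suc\<close>). In particular \<open>S 1 = 2\<close>, where only \<open>m = 0\<close> contributes, and all
  the \<open>S k\<close> are finite by induction.

  For \<open>k \<ge> 1\<close> the number \<open>2 / (2 * m + 1) = 1 / (m + 1 / 2)\<close> is close to \<open>1 / m\<close>, so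
  \<open>S (k + 1)\<close> is \<open>S k\<close> minus the sum of the gaps \<open>1 / m - 2 / (2 * m + 1)\<close> over the \<open>m\<close> with
  \<open>k\<close> ones (\<open>has_sum_gap_s2\<close>). When these differences are added up over all \<open>k \<ge> 1\<close>, the left
  side telescopes to \<open>S 1 - lim S\<close>, while on the right each \<open>m \<ge> 1\<close> is met exactly once,
  whatever its digits. So \<open>2 - lim S\<close> is the sum of all the gaps, which the alternating harmonic
  series evaluates to \<open>2 - 2 * ln 2\<close> (\<open>has_sum_gap\<close>).
\<close>

lemma s2_0 [simp]: "s2 0 = 0"
  by (simp add: s2.simps)

lemma s2_double: "s2 (2 * n) = s2 n"
  by (cases "n = 0") (simp_all add: s2.simps[of "2 * n"])

lemma s2_odd: "s2 (2 * n + 1) = Suc (s2 n)"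
  by (simp add: s2.simps[of "Suc (2 * n)"])

lemma s2_power2_mult: "s2 (2 ^ j * n) = s2 n"
  by (induction j) (simp_all add: s2_double mult.assoc)

lemma s2_eq_0_iff: "s2 n = 0 \<longleftrightarrow> n = 0"
proof (induction n rule: s2.induct)
  case (1 n)
  show ?case
  proof (cases "n = 0")
    case False
    have "s2 n = n mod 2 + s2 (n div 2)"
      using False by (simp add: s2.simps[of n])
    then show ?thesis
      using 1[OF False] by auto
  qed simp
qed

text \<open>
  Factoring out the largest power of two removes the trailing zeros of the binary expansion;
  halving the remaining odd number then removes exactly one digit \<open>1\<close>.
\<close>

lemma bij_betw_odd_part:
  "bij_betw (\<lambda>(m, j). 2 ^ j * (2 * m + 1)) ({m. s2 m = k} \<times> UNIV) {n. n \<ge> 1 \<and> s2 n = Suc k}"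
  unfolding bij_betw_def
proof (intro conjI inj_onI)
  fix p q :: "nat \<times> nat"
  assume "(case p of (m, j) \<Rightarrow> 2 ^ j * (2 * m + 1)) = (case q of (m, j) \<Rightarrow> 2 ^ j * (2 * m + 1))"
  moreover obtain m i m' j where pq: "p = (m, i)" "q = (m', j)"
    by (metis surj_pair)
  ultimately have eq: "2 ^ i * (2 * m + 1) = 2 ^ j * (2 * m' + 1)"
    by simp
  have val: "multiplicity 2 (2 ^ i * (2 * m + 1)) = i" for i m :: nat
  proof (rule multiplicity_eqI)
    show "\<not> 2 ^ Suc i dvd 2 ^ i * (2 * m + 1)"
      unfolding power_Suc2 by (subst dvd_times_left_cancel_iff) auto
  qed simp
  have "i = j"
    using val[of i m] val[of j m'] eq by metis
  then show "p = q"
    using eq pq by simp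
next
  show "(\<lambda>(m, j). 2 ^ j * (2 * m + 1)) ` ({m. s2 m = k} \<times> UNIV) = {n. n \<ge> 1 \<and> s2 n = Suc k}"
    (is "?f ` ?A = ?B")
  proof
    show "?f ` ?A \<subseteq> ?B"
    proof (rule image_subsetI)
      fix p assume "p \<in> ?A"
      then obtain m j where "p = (m, j)" "s2 m = k"
        by blast
      then show "?f p \<in> ?B"
        by (simp only: case_prod_conv mem_Collect_eq s2_power2_mult s2_odd) (simp add: Suc_le_eq)
    qed
  next
    show "?B \<subseteq> ?f ` ?A"
    proof
      fix n assume n: "n \<in> ?B"
      define j where "j = multiplicity 2 n"
      have "n \<noteq> 0" "\<not> 2 dvd (1 :: nat)"
        using n by auto
      then obtain r where "n = 2 ^ multiplicity 2 n * r" "odd r"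
        by (rule multiplicity_decompose')
      then have r: "n = 2 ^ j * r" "odd r"
        unfolding j_def by blast+
      from r(2) obtain m where "r = 2 * m + 1"
        by (elim oddE)
      then have m: "n = ?f (m, j)"
        using r(1) by simp
      have "s2 m = k"
        using n unfolding m case_prod_conv mem_Collect_eq s2_power2_mult s2_odd by simp
      with m show "n \<in> ?f ` ?A"
        by blast
    qed
  qed
qed

text \<open>
  The factor \<open>2\<close> is the geometric series \<open>\<Sum>j. (1 / 2) ^ j\<close>, which collects all the numbers with the
  same odd part.
\<close>

lemma has_sum_inverse_s2_Suc:
  assumes "((\<lambda>m. 1 / (2 * real m + 1)) has_sum t) {m. s2 m = k}"
  shows "((\<lambda>n. 1 / real n) has_sum (2 * t)) {n. n \<ge> 1 \<and> s2 n = Suc k}"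
proof -
  define f :: "nat \<times> nat \<Rightarrow> real" where "f = (\<lambda>(m, j). 1 / (2 * real m + 1) * (1 / 2) ^ j)"
  have geometric: "((\<lambda>j. (1 / 2 :: real) ^ j) has_sum 2) UNIV"
    using geometric_sums[of "1 / 2 :: real"] by (intro sums_nonneg_imp_has_sum) auto
  have inner: "((\<lambda>j. f (m, j)) has_sum (2 * (1 / (2 * real m + 1)))) UNIV" for m
    using has_sum_cmult_right[OF geometric, of "1 / (2 * real m + 1)"]
    by (simp add: f_def)
  have outer: "((\<lambda>m. 2 * (1 / (2 * real m + 1))) has_sum (2 * t)) {m. s2 m = k}"
    using assms by (rule has_sum_cmult_right)
  have "f summable_on {m. s2 m = k} \<times> UNIV"
    by (rule summable_on_SigmaI[OF inner has_sum_imp_summable[OF outer]]) (simp add: f_def)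
  then have "(f has_sum (2 * t)) ({m. s2 m = k} \<times> UNIV)"
    by (rule has_sum_SigmaI[OF inner outer])
  also have "f = (\<lambda>p. 1 / real (case p of (m, j) \<Rightarrow> 2 ^ j * (2 * m + 1)))"
    by (simp add: f_def fun_eq_iff power_one_over ring_distribs mult.commute)
  finally show ?thesis
    using has_sum_reindex_bij_betw[OF bij_betw_odd_part] by fast
qed

lemma summable_on_inverse_odd:
  assumes "(\<lambda>n. 1 / real n) summable_on {n. n \<ge> 1 \<and> P n}"
  shows "(\<lambda>m. 1 / (2 * real m + 1)) summable_on {n. n \<ge> 1 \<and> P n}"
  using assms by (rule summable_on_comparison_test) (auto simp: frac_le)

lemma summable_on_inverse_s2: "(\<lambda>n. 1 / real n) summable_on {n. n \<ge> 1 \<and> s2 n = k}"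
proof (induction k)
  case 0
  have "{n. n \<ge> 1 \<and> s2 n = 0} = {}"
    by (auto simp: s2_eq_0_iff)
  then show ?case
    by (simp only: summable_on_empty)
next
  case (Suc k)
  have "(\<lambda>m. 1 / (2 * real m + 1)) summable_on {m. s2 m = k}"
  proof (cases "k = 0")
    case True
    then show ?thesis
      by (simp add: s2_eq_0_iff)
  next
    case False
    then have "{m. s2 m = k} = {m. m \<ge> 1 \<and> s2 m = k}"
      by (auto simp: Suc_le_eq intro!: gr0I)
    then show ?thesis
      using summable_on_inverse_odd[OF Suc] by (simp only:)
  qed
  then show ?case
    using has_sum_inverse_s2_Suc by (meson summable_on_def)
qed

text \<open>
  The condition \<open>k \<ge> 1\<close> excludes \<open>m = 0\<close>, which contributes to \<open>\<Sum> 2 / (2 * m + 1)\<close> but has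
  no counterpart among the \<open>1 / m\<close>.
\<close>

lemma has_sum_gap_s2:
  assumes "k \<ge> 1"
  shows "((\<lambda>m. 1 / real m - 2 / (2 * real m + 1)) has_sum
           ((\<Sum>\<^sub>\<infinity>n\<in>{n. n \<ge> 1 \<and> s2 n = k}. 1 / real n)
             - (\<Sum>\<^sub>\<infinity>n\<in>{n. n \<ge> 1 \<and> s2 n = Suc k}. 1 / real n)))
         {m. m \<ge> 1 \<and> s2 m = k}"
proof -
  have eq: "{m. m \<ge> 1 \<and> s2 m = k} = {m. s2 m = k}"
    using assms by (auto simp: Suc_le_eq intro!: gr0I)
  obtain t where t: "((\<lambda>m. 1 / (2 * real m + 1)) has_sum t) {m. m \<ge> 1 \<and> s2 m = k}"
    using summable_on_inverse_odd[OF summable_on_inverse_s2] unfolding summable_on_def by blast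
  have "(\<Sum>\<^sub>\<infinity>n\<in>{n. n \<ge> 1 \<and> s2 n = Suc k}. 1 / real n) = 2 * t"
    by (rule infsumI[OF has_sum_inverse_s2_Suc[OF t[unfolded eq]]])
  then show ?thesis
    using has_sum_add[OF has_sum_infsum[OF summable_on_inverse_s2] has_sum_cmult_right[OF t, of "-2"]]
    by simp
qed

text \<open>
  Each gap is \<open>2 * (1 / (2 * m) - 1 / (2 * m + 1))\<close>, so the gaps are, up to the factor \<open>-2\<close>, the
  consecutive pairs of terms of \<open>ln 2 = 1 - 1 / 2 + 1 / 3 - \<dots>\<close> once its leading \<open>1\<close> is split off.
\<close>

lemma has_sum_gap:
  "((\<lambda>m. 1 / real m - 2 / (2 * real m + 1)) has_sum (2 - 2 * ln 2)) {1..}"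
proof -
  have pair: "sum f {n * 2..<n * 2 + 2} = f (n * 2) + f (Suc (n * 2))" for f :: "nat \<Rightarrow> real" and n
    by (simp add: numeral_2_eq_2)
  have "(\<lambda>k. (-1) ^ Suc k / real (Suc (Suc k))) sums (ln 2 - 1)"
    using sums_split_initial_segment[OF alternating_harmonic_series_sums, of 1] by simp
  from sums_mult[OF sums_group[OF this, of 2], of "-2"]
  have "(\<lambda>j. -2 * ((-1) ^ Suc (j * 2) / real (Suc (Suc (j * 2)))
               + (-1) ^ Suc (Suc (j * 2)) / real (Suc (Suc (Suc (j * 2)))))) sums (-2 * (ln 2 - 1))"
    unfolding pair by simp
  also have "(\<lambda>j. -2 * ((-1) ^ Suc (j * 2) / real (Suc (Suc (j * 2)))
               + (-1) ^ Suc (Suc (j * 2)) / real (Suc (Suc (Suc (j * 2))))))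
             = (\<lambda>j. 1 / real (Suc j) - 2 / (2 * real (Suc j) + 1))"
  proof
    fix j
    have "1 / real (Suc j) = 2 / real (Suc (Suc (j * 2)))"
      by (simp add: field_simps)
    then show "-2 * ((-1) ^ Suc (j * 2) / real (Suc (Suc (j * 2)))
                 + (-1) ^ Suc (Suc (j * 2)) / real (Suc (Suc (Suc (j * 2)))))
               = 1 / real (Suc j) - 2 / (2 * real (Suc j) + 1)"
      by (simp add: algebra_simps)
  qed
  finally have "((\<lambda>j. 1 / real (Suc j) - 2 / (2 * real (Suc j) + 1)) has_sum (-2 * (ln 2 - 1))) UNIV"
    by (rule sums_nonneg_imp_has_sum) (simp add: field_simps)
  moreover have "bij_betw Suc UNIV {1..}"
    by (rule bij_betw_byWitness[of _ "\<lambda>m. m - 1"]) auto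
  ultimately show ?thesis
    using has_sum_reindex_bij_betw[of Suc UNIV "{1..}"
        "\<lambda>m. 1 / real m - 2 / (2 * real m + 1)" "2 - 2 * ln 2"]
    by (simp add: algebra_simps)
qed

theorem theorem1:
  "(\<lambda>k. \<Sum>\<^sub>\<infinity>n\<in>{n::nat. n \<ge> 1 \<and> s2 n = k}. 1 / real n) \<longlonglongrightarrow> 2 * ln 2"
proof -
  define S where "S k = (\<Sum>\<^sub>\<infinity>n\<in>{n::nat. n \<ge> 1 \<and> s2 n = k}. 1 / real n)" for k
  have "((\<lambda>m. 1 / (2 * real m + 1)) has_sum 1) {m. s2 m = 0}"
    using has_sum_finite[of "{0::nat}" "\<lambda>m. 1 / (2 * real m + 1)"] by (simp add: s2_eq_0_iff)
  from infsumI[OF has_sum_inverse_s2_Suc[OF this]] have S1: "S (Suc 0) = 2"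
    by (simp add: S_def)
  \<comment> \<open>The positive integers are partitioned by their number of ones.\<close>
  have "bij_betw snd (SIGMA k:UNIV. {m. m \<ge> 1 \<and> s2 m = Suc k}) {1..}"
    by (rule bij_betw_byWitness[of _ "\<lambda>m. (s2 m - 1, m)"]) (auto simp: s2_eq_0_iff Suc_le_eq intro!: Suc_pred[symmetric] gr0I)
  from iffD2[OF has_sum_reindex_bij_betw[OF this] has_sum_gap]
  have "((\<lambda>k. S (Suc k) - S (Suc (Suc k))) has_sum (2 - 2 * ln 2)) UNIV"
    unfolding S_def by (rule has_sum_SigmaD) (use has_sum_gap_s2 in simp)
  then have "(\<lambda>n. \<Sum>k<n. S (Suc k) - S (Suc (Suc k))) \<longlonglongrightarrow> 2 - 2 * ln 2"
    using has_sum_imp_sums unfolding sums_def by blast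
  also have "(\<lambda>n. \<Sum>k<n. S (Suc k) - S (Suc (Suc k))) = (\<lambda>n. 2 - S (Suc n))"
    using S1 sum_lessThan_telescope'[of "\<lambda>k. S (Suc k)"] by simp
  finally have "(\<lambda>n. 2 - S (Suc n)) \<longlonglongrightarrow> 2 - 2 * ln 2" .
  from tendsto_diff[OF tendsto_const[of 2] this] have "(\<lambda>n. S (Suc n)) \<longlonglongrightarrow> 2 * ln 2"
    by (simp only: diff_diff_eq2 add_diff_cancel_left')
  then show ?thesis
    unfolding S_def by (rule LIMSEQ_imp_Suc)
qed

end
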